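(* Let $q=p^h$ with $p$ prime and $q>2$. Let $\mathcal{D}_1$ and $\mathcal{D}_2$ be two Desarguesian $(n-1)$-spreads in $\mathrm{PG}(2n-1,q)$ with at least $3$ elements in common. Then $\mathcal{D}_1$ and $\mathcal{D}_2$ share exactly $q^t+1$ elements for some $t\mid n$. In particular, if $n$ is prime, then $\mathcal{D}_1$ and $\mathcal{D}_2$ share a regulus or coincide.
   Context: An $(n-1)$-spread of $\mathrm{PG}(2n-1,q)$ is a set of $(n-1)$-spaces (projective dimension) partitioning the point set. Given an $\mathbb{F}_q$-linear isomorphism $\mathbb{F}_{q^n}^2\cong\mathbb{F}_q^{2n}$, each point of $\mathrm{PG}(1,q^n)$ (a 1-dimensional $\mathbb{F}_{q^n}$-subspace) corresponds to an $(n-1)$-space of $\mathrm{PG}(2n-1,q)$; a Desarguesian $(n-1)$-spread is the set of all $(n-1)$-spaces arising in this way from the points of $\mathrm{PG}(1,q^n)$, for some such isomorphism. A regulus in $\mathrm{PG}(2n-1,q)$ is a set of $q+1$ mutually disjoint $(n-1)$-spaces such that every line meeting $3$ of its elements meets all of its elements. "Share a regulus" means that the set of common elements is a regulus (the case of exactly $q+1$ common elements). *)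

theory Defs
  imports "HOL-Analysis.Cartesian_Space" "HOL-Computational_Algebra.Primes"
begin

text \<open>Projective geometry over a field \<open>'a\<close>: a projective space of projective dimension \<open>d\<close>
  is represented by the corresponding vector subspace of \<open>'a ^ 'm\<close>, of vector dimension \<open>d + 1\<close>.
  The ambient geometry is PG(CARD('m) - 1, CARD('a)).\<close>

definition pg_spaces :: "nat \<Rightarrow> ('a::field ^ 'm) set set" where
  "pg_spaces d = {U. vec.subspace U \<and> vec.dim U = d + 1}"

text \<open>As vector subspaces, any two spaces share the zero vector; meeting and disjointness refer
  to projective points.\<close>

definition pg_meets :: "('a::field ^ 'm) set \<Rightarrow> ('a ^ 'm) set \<Rightarrow> bool" where
  "pg_meets U W \<longleftrightarrow> (\<exists>P\<in>pg_spaces 0. P \<subseteq> U \<and> P \<subseteq> W)"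

definition regulus :: "nat \<Rightarrow> ('a::{field,finite} ^ 'm) set set \<Rightarrow> bool" where
  "regulus n R \<longleftrightarrow>
     R \<subseteq> pg_spaces (n - 1) \<and>
     card R = CARD('a) + 1 \<and>
     (\<forall>U\<in>R. \<forall>W\<in>R. U \<noteq> W \<longrightarrow> \<not> pg_meets U W) \<and>
     (\<forall>L\<in>pg_spaces 1.
        (\<exists>A\<in>R. \<exists>B\<in>R. \<exists>C\<in>R. A \<noteq> B \<and> A \<noteq> C \<and> B \<noteq> C \<and>
           pg_meets L A \<and> pg_meets L B \<and> pg_meets L C) \<longrightarrow>
        (\<forall>U\<in>R. pg_meets L U))"

definition field_embedding :: "('a::field \<Rightarrow> 'k::field) \<Rightarrow> bool" where
  "field_embedding e \<longleftrightarrow>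
     e 1 = 1 \<and> (\<forall>x y. e (x + y) = e x + e y) \<and> (\<forall>x y. e (x * y) = e x * e y)"

text \<open>The embedding \<open>e\<close> makes \<open>'k\<close> an extension field of \<open>'a\<close>, so that \<open>'k ^ 2\<close> is an
  \<open>'a\<close>-vector space by restriction of scalars. Linearity of \<open>\<phi>\<close> is over \<open>'a\<close>, whereas
  \<^term>\<open>pg_spaces 0\<close> below is the set of points of the projective line over \<open>'k\<close>.\<close>

definition desarguesian_spread ::
  "('a::field \<Rightarrow> 'k::field) \<Rightarrow> ('a ^ 'm) set set \<Rightarrow> bool" where
  "desarguesian_spread e D \<longleftrightarrow>
     (\<exists>\<phi> :: 'k ^ 2 \<Rightarrow> 'a ^ 'm.
        Vector_Spaces.linear (\<lambda>a x. e a *s x) (*s) \<phi> \<and> bij \<phi> \<and>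
        D = (\<lambda>P. \<phi> ` P) ` (pg_spaces 0 :: ('k ^ 2) set set))"

end

theory Submission imports Defs begin

text \<open>Write F for \<open>'a\<close>, identified with its image under \<open>e\<close>, and K
  for \<open>'k\<close>. Three common elements A, B, C can play the roles of 0, infinity and 1 on
  the projective line over K for both spreads: \<open>desarguesian_spread_coordinates\<close>
  identifies the ambient space with K x K so that the spread consists of the graphs y = c x and the
  space x = 0, while A, B, C become y = 0, x = 0, y = x. As A, B, C have the same equations in both
  identifications, the change of coordinates is (x, y) to (f x, f y) for a single F-linear bijection
  f of K. The element y = c x of the first spread belongs to the second iff multiplication by c is
  the conjugate under f of multiplication by some m. Such c form a subfield S of K containing F,
  since they describe the intersection of the field of multiplications with its conjugate
  (\<open>common_elements\<close>). Hence there are |S| + 1 common elements.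

  Counting S as a module over F and K as a module over S (\<open>card_submodule_power\<close>) gives
  |S| = q^t and q^n = |S|^r, so n = t r. For n prime, t = n makes the spreads equal, and t = 1 makes
  S = F. In the latter case a line meeting A, B, C contains (z, 0) and (0, z) for some nonzero z,
  hence (z, a z) for all a in F, and so it meets every common element
  (\<open>common_elements_regulus\<close>).\<close>

section \<open>Projective points, incidence and cardinality of subspaces\<close>

lemma pg_spaces_0E:
  assumes "P \<in> pg_spaces 0"
  obtains v where "v \<noteq> 0" and "P = range (\<lambda>c. c *s v)"
proof -
  have P: "vec.subspace P" "vec.dim P = 1"
    using assms by (auto simp: pg_spaces_def)
  obtain B where B: "B \<subseteq> P" "vec.independent B" "P \<subseteq> vec.span B" "card B = vec.dim P"
    using vec.basis_exists by blast
  obtain v where v: "B = {v}"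
    using B(4) P(2) by (auto simp: card_1_singleton_iff)
  have "v \<noteq> 0"
    using B(2) v vec.dependent_zero by auto
  moreover have "P = vec.span B"
    using B(1,3) P(1) vec.span_minimal by blast
  ultimately show thesis
    using that v vec.span_singleton by metis
qed

lemma pg_spaces_0I:
  fixes v :: "'a::field ^ 'm"
  assumes "v \<noteq> 0"
  shows "range (\<lambda>c. c *s v) \<in> pg_spaces 0"
proof -
  have "vec.independent {v}"
    using assms by simp
  then have "vec.dim (vec.span {v}) = 1"
    by (metis One_nat_def card.empty card_insert_disjoint empty_iff finite.emptyI
        vec.dim_span_eq_card_independent)
  then show ?thesis
    by (auto simp: pg_spaces_def vec.span_singleton[symmetric])
qed

text \<open>Projective points are spans of nonzero vectors, so incidence can be decided on vectors,
  where coordinates apply.\<close>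

lemma pg_meets_iff:
  assumes "vec.subspace U" and "vec.subspace W"
  shows "pg_meets U W \<longleftrightarrow> (\<exists>v. v \<noteq> 0 \<and> v \<in> U \<and> v \<in> W)"
proof
  assume "pg_meets U W"
  then obtain P where P: "P \<in> pg_spaces 0" "P \<subseteq> U" "P \<subseteq> W"
    by (auto simp: pg_meets_def)
  obtain v where v: "v \<noteq> 0" "P = range (\<lambda>c. c *s v)"
    using P(1) by (rule pg_spaces_0E)
  have "v \<in> P"
    unfolding v(2) by (rule range_eqI[of _ _ 1]) simp
  then show "\<exists>v. v \<noteq> 0 \<and> v \<in> U \<and> v \<in> W"
    using P v by blast
next
  assume "\<exists>v. v \<noteq> 0 \<and> v \<in> U \<and> v \<in> W"
  then obtain v where v: "v \<noteq> 0" "v \<in> U" "v \<in> W" by blast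
  then have "range (\<lambda>c. c *s v) \<subseteq> U" "range (\<lambda>c. c *s v) \<subseteq> W"
    using assms by (auto intro: vec.subspace_scale)
  then show "pg_meets U W"
    using pg_spaces_0I[OF v(1)] by (auto simp: pg_meets_def)
qed

text \<open>Adjoining an independent vector to a basis multiplies the size of the span by
  \<open>CARD('a)\<close>. The lemma serves to recover the dimension of a spread element from its
  cardinality.\<close>

lemma card_subspace:
  fixes U :: "('a::{field,finite} ^ 'm::finite) set"
  assumes "vec.subspace U"
  shows "card U = CARD('a) ^ vec.dim U"
proof -
  obtain B where B: "B \<subseteq> U" "vec.independent B" "U \<subseteq> vec.span B" "card B = vec.dim U"
    using vec.basis_exists by blast
  have "U = vec.span B"
    using B(1,3) assms vec.span_minimal by blast
  moreover have "card (vec.span B) = CARD('a) ^ card B"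
    using finite[of B] B(2)
  proof (induction B rule: finite_induct)
    case empty
    then show ?case by simp
  next
    case (insert b B)
    have b: "b \<notin> vec.span B" and ind: "vec.independent B"
      using insert.prems insert.hyps by (auto simp: vec.independent_insert)
    have eq: "vec.span (insert b B) = (\<lambda>(c, w). c *s b + w) ` (UNIV \<times> vec.span B)"
      (is "_ = ?f ` _")
    proof (intro equalityI subsetI)
      fix x assume "x \<in> vec.span (insert b B)"
      then obtain c where "x - c *s b \<in> vec.span B"
        using vec.span_insert by blast
      then show "x \<in> ?f ` (UNIV \<times> vec.span B)"
        by (intro image_eqI[of _ _ "(c, x - c *s b)"]) auto
    next
      fix x assume "x \<in> ?f ` (UNIV \<times> vec.span B)"
      then obtain c w where "x = c *s b + w" "w \<in> vec.span B" by auto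
      then have "x - c *s b \<in> vec.span B" by simp
      then show "x \<in> vec.span (insert b B)"
        unfolding vec.span_insert by blast
    qed
    have "inj_on ?f (UNIV \<times> vec.span B)"
    proof (rule inj_onI, clarsimp)
      fix c w c' w'
      assume w: "w \<in> vec.span B" "w' \<in> vec.span B" and eq: "c *s b + w = c' *s b + w'"
      have *: "(c - c') *s b = w' - w"
        using eq by (simp add: vec.scale_left_diff_distrib algebra_simps)
      have "c = c'"
      proof (rule ccontr)
        assume "c \<noteq> c'"
        then have "b = inverse (c - c') *s (w' - w)"
          by (simp add: *[symmetric])
        then show False
          using b w by (metis vec.span_diff vec.span_scale)
      qed
      then show "c = c' \<and> w = w'" using eq by simp
    qed
    then show ?case
      using insert by (simp add: eq card_image ind card_cartesian_product)
  qed
  ultimately show ?thesis using B(4) by simp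
qed

section \<open>Subfields and the size of modules over them\<close>

text \<open>A predicate on sets, because the subfield of interest depends on the two spreads.
  Closure under \<open>inverse\<close> can be asked of 0 as well, since
  \<open>inverse 0 = 0\<close>.\<close>

definition subfield_set :: "'k::field set \<Rightarrow> bool" where
  "subfield_set S \<longleftrightarrow> 0 \<in> S \<and> 1 \<in> S \<and> (\<forall>x\<in>S. \<forall>y\<in>S. x - y \<in> S \<and> x * y \<in> S) \<and>
     (\<forall>x\<in>S. inverse x \<in> S)"

text \<open>A largest subset of \<open>W\<close> that is an \<open>S\<close>-submodule of cardinality a power of \<open>card S\<close>
  must be all of \<open>W\<close>, since adjoining a further vector multiplies the cardinality by \<open>card S\<close>.\<close>

lemma card_submodule_power:
  fixes S W :: "'k::{field,finite} set"
  assumes S: "subfield_set S"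
    and W: "0 \<in> W" "\<And>x y. x \<in> W \<Longrightarrow> y \<in> W \<Longrightarrow> x + y \<in> W" "\<And>s x. s \<in> S \<Longrightarrow> x \<in> W \<Longrightarrow> s * x \<in> W"
  shows "\<exists>r. card W = card S ^ r"
proof -
  have S0: "0 \<in> S" and S1: "1 \<in> S" and Sd: "\<And>x y. x \<in> S \<Longrightarrow> y \<in> S \<Longrightarrow> x - y \<in> S"
    and Sm: "\<And>x y. x \<in> S \<Longrightarrow> y \<in> S \<Longrightarrow> x * y \<in> S" and Si: "\<And>x. x \<in> S \<Longrightarrow> inverse x \<in> S"
    using S by (auto simp: subfield_set_def)
  have Sa: "x + y \<in> S" if "x \<in> S" "y \<in> S" for x y
    using Sd[OF that(1) Sd[OF S0 that(2)]] by simp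
  define good where "good U \<longleftrightarrow> U \<subseteq> W \<and> 0 \<in> U \<and> (\<forall>x\<in>U. \<forall>y\<in>U. x + y \<in> U) \<and>
    (\<forall>s\<in>S. \<forall>x\<in>U. s * x \<in> U) \<and> (\<exists>r. card U = card S ^ r)" for U
  have "good {0}"
    using W by (auto simp: good_def intro!: exI[of _ 0])
  \<comment> \<open>A good set of greatest size exists because sizes are bounded by
    \<open>CARD('k)\<close>.\<close>
  then obtain U where U: "good U" and max: "\<And>T. good T \<Longrightarrow> card T \<le> card U"
    using ex_has_greatest_nat[of good "{0}" card "CARD('k) + 1"]
    by (metis card_mono finite le_add1 order.trans subset_UNIV less_eq_Suc_le less_Suc_eq_le Suc_eq_plus1)
  have "U = W"
  proof (rule ccontr)
    assume "U \<noteq> W"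
    then obtain w where w: "w \<in> W" "w \<notin> U"
      using U by (auto simp: good_def)
    \<comment> \<open>\<open>f\<close> parametrises the submodule S w + U. It is injective on
      \<open>S \<times> U\<close>: two representations with different coefficients of
      \<open>w\<close> would put \<open>w\<close> into \<open>U\<close>.\<close>
    define f where "f = (\<lambda>(s, u). s * w + u)"
    obtain r where r: "card U = card S ^ r"
      using U by (auto simp: good_def)
    have Um: "u - v \<in> U" if "u \<in> U" "v \<in> U" for u v
    proof -
      have "- 1 * v \<in> U"
        using U that Sd[OF S0 S1] unfolding good_def by fastforce
      then show ?thesis
        using U that(1) unfolding good_def by fastforce
    qed
    have "inj_on f (S \<times> U)"
    proof (rule inj_onI, clarsimp simp: f_def)
      fix s u s' u'
      assume *: "s \<in> S" "u \<in> U" "s' \<in> S" "u' \<in> U" and eq: "s * w + u = s' * w + u'"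
      have "s = s'"
      proof (rule ccontr)
        assume "s \<noteq> s'"
        moreover have "(s - s') * w = u' - u"
          using eq by (simp add: algebra_simps)
        ultimately have "w = inverse (s - s') * (u' - u)"
          by (simp add: field_simps)
        then show False
          using w(2) U Um * Si Sd unfolding good_def by metis
      qed
      then show "s = s' \<and> u = u'" using eq by simp
    qed
    then have card: "card (f ` (S \<times> U)) = card S ^ Suc r"
      by (simp add: card_image card_cartesian_product r)
    have "good (f ` (S \<times> U))"
      unfolding good_def
    proof (intro conjI ballI)
      show "f ` (S \<times> U) \<subseteq> W"
        using W w U by (auto simp: f_def good_def)
      show "0 \<in> f ` (S \<times> U)"
        using U S0 by (auto simp: f_def good_def intro!: image_eqI[of _ _ "(0, 0)"])
      show "x + y \<in> f ` (S \<times> U)" if xy: "x \<in> f ` (S \<times> U)" "y \<in> f ` (S \<times> U)" for x y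
      proof -
        obtain s u s' u' where *: "s \<in> S" "u \<in> U" "s' \<in> S" "u' \<in> U"
          "x = s * w + u" "y = s' * w + u'"
          using xy by (auto simp: f_def)
        then show ?thesis
          using U Sa by (intro image_eqI[of _ _ "(s + s', u + u')"])
            (auto simp: f_def good_def algebra_simps)
      qed
      show "t * x \<in> f ` (S \<times> U)" if tx: "t \<in> S" "x \<in> f ` (S \<times> U)" for t x
      proof -
        obtain s u where *: "s \<in> S" "u \<in> U" "x = s * w + u"
          using tx(2) by (auto simp: f_def)
        then show ?thesis
          using U Sm tx(1) by (intro image_eqI[of _ _ "(t * s, t * u)"])
            (auto simp: f_def good_def algebra_simps)
      qed
      show "\<exists>r. card (f ` (S \<times> U)) = card S ^ r"
        using card by blast
    qed
    then have "card S ^ Suc r \<le> card S ^ r"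
      using max card r by metis
    moreover have "card S \<ge> 2"
      using card_mono[of S "{0, 1}"] S0 S1 by simp
    ultimately show False by simp
  qed
  then show ?thesis using U by (auto simp: good_def)
qed

section \<open>Coordinates for a Desarguesian spread\<close>

text \<open>A bijection from pairs over \<open>'k\<close> to the ambient space, linear over
  \<open>'a\<close> through \<open>e\<close>; it is the map of a Desarguesian spread, curried and
  relative to a chosen basis of \<open>'k ^ 2\<close>.\<close>

locale plane_coordinates =
  fixes e :: "'a::field \<Rightarrow> 'k::field" and \<phi> :: "'k \<Rightarrow> 'k \<Rightarrow> 'a ^ 'm"
  assumes add: "\<phi> (x + x') (y + y') = \<phi> x y + \<phi> x' y'"
    and scale: "\<phi> (e a * x) (e a * y) = a *s \<phi> x y"
    and inj: "\<phi> x y = \<phi> x' y' \<longleftrightarrow> x = x' \<and> y = y'"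
    and surj: "\<exists>x y. v = \<phi> x y"
begin

text \<open>The points of the projective line over \<open>'k\<close> are described by an affine
  coordinate: \<open>slope c\<close> is the graph y = c x, and \<open>vertical\<close> is the point
  at infinity.\<close>

definition slope :: "'k \<Rightarrow> ('a ^ 'm) set" where
  "slope c = range (\<lambda>x. \<phi> x (c * x))"

definition vertical :: "('a ^ 'm) set" where
  "vertical = range (\<phi> 0)"

definition spread :: "('a ^ 'm) set set" where
  "spread = insert vertical (range slope)"

lemma zero: "\<phi> 0 0 = 0"
  using add[of 0 0 0 0] by simp

lemma eq_0_iff: "\<phi> x y = 0 \<longleftrightarrow> x = 0 \<and> y = 0"
  using inj[of x y 0 0] zero by simp

lemma in_slope_iff: "\<phi> x y \<in> slope c \<longleftrightarrow> y = c * x"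
  by (auto simp: slope_def inj)

lemma in_vertical_iff: "\<phi> x y \<in> vertical \<longleftrightarrow> x = 0"
  by (auto simp: vertical_def inj)

lemma slope_inject: "slope c = slope d \<longleftrightarrow> c = d"
  using in_slope_iff[of 1 c c] in_slope_iff[of 1 c d] by auto

lemma slope_neq_vertical: "slope c \<noteq> vertical"
  using in_slope_iff[of 0 1 c] in_vertical_iff[of 0 1] by auto

lemma subspace_spread:
  assumes "U \<in> spread"
  shows "vec.subspace U"
proof -
  have s: "vec.subspace (slope c)" for c
    unfolding vec.subspace_def
  proof (intro conjI ballI allI)
    show "0 \<in> slope c"
      using in_slope_iff[of 0 0] zero by simp
    show "u + v \<in> slope c" if "u \<in> slope c" "v \<in> slope c" for u v
      using that by (auto simp: slope_def add[symmetric] distrib_left[symmetric])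
    show "a *s u \<in> slope c" if "u \<in> slope c" for a u
    proof -
      obtain x where "u = \<phi> x (c * x)"
        using \<open>u \<in> slope c\<close> by (auto simp: slope_def)
      \<comment> \<open>Multiplication by \<open>c\<close> commutes with multiplication by
        \<open>e a\<close>, so the graph is closed under scalars from \<open>'a\<close>.\<close>
      then have "a *s u = \<phi> (e a * x) (c * (e a * x))"
        by (simp add: scale[symmetric] mult.left_commute)
      then show ?thesis by (simp add: in_slope_iff)
    qed
  qed
  have v: "vec.subspace vertical"
    unfolding vec.subspace_def
  proof (intro conjI ballI allI)
    show "0 \<in> vertical"
      using in_vertical_iff[of 0 0] zero by simp
    show "u + v \<in> vertical" if "u \<in> vertical" "v \<in> vertical" for u v
      using that by (auto simp: vertical_def add[symmetric])
    show "a *s u \<in> vertical" if "u \<in> vertical" for a u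
    proof -
      obtain y where "u = \<phi> 0 y"
        using \<open>u \<in> vertical\<close> by (auto simp: vertical_def)
      then have "a *s u = \<phi> 0 (e a * y)"
        using scale[of a 0 y] by simp
      then show ?thesis by (simp add: in_vertical_iff)
    qed
  qed
  show ?thesis
    using assms s v by (auto simp: spread_def)
qed

text \<open>A nonzero vector with coordinates (x, y) determines its element: the slope is y / x, or
  the element is vertical if x = 0.\<close>

lemma disjoint_spread:
  assumes "U \<in> spread" "W \<in> spread" "v \<in> U" "v \<in> W" "v \<noteq> 0"
  shows "U = W"
proof -
  obtain x y where "v = \<phi> x y" using surj by blast
  then show ?thesis
    using assms by (auto simp: spread_def in_slope_iff in_vertical_iff eq_0_iff)
qed

text \<open>The extra 1 is the element at infinity; it becomes the 1 in q^t + 1. With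
  \<open>S = UNIV\<close> this counts the whole spread.\<close>

lemma card_slopes: "card (insert vertical (slope ` S)) = card S + 1" if "finite S"
proof -
  have "card (slope ` S) = card S"
    by (rule card_image) (auto simp: inj_on_def slope_inject)
  moreover have "vertical \<notin> slope ` S"
    using slope_neq_vertical by (metis imageE)
  ultimately show ?thesis
    using that by simp
qed

lemma card_spread_element:
  assumes "U \<in> spread"
  shows "card U = CARD('k)"
proof -
  have "card (slope c) = CARD('k)" for c
    unfolding slope_def by (rule card_image) (auto simp: inj_on_def inj)
  moreover have "card vertical = CARD('k)"
    unfolding vertical_def by (rule card_image) (auto simp: inj_on_def inj)
  ultimately show ?thesis
    using assms by (auto simp: spread_def)
qed

end

text \<open>Three distinct points of the projective line over \<open>'k\<close> are spanned by vectors
  \<open>a\<close>, \<open>b\<close> and \<open>a + b\<close>; these provide the coordinates.\<close>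

lemma desarguesian_spread_coordinates:
  fixes e :: "'a::field \<Rightarrow> 'k::{field,finite}" and D :: "('a ^ 'm) set set"
  assumes "desarguesian_spread e D"
    and ABC: "A \<in> D" "B \<in> D" "C \<in> D" "A \<noteq> B" "A \<noteq> C" "B \<noteq> C"
  obtains \<phi> where "plane_coordinates e \<phi>" and "D = plane_coordinates.spread \<phi>"
    and "A = plane_coordinates.slope \<phi> 0" and "B = plane_coordinates.vertical \<phi>"
    and "C = plane_coordinates.slope \<phi> 1"
proof -
  obtain \<Phi> :: "'k ^ 2 \<Rightarrow> 'a ^ 'm" where
    lin: "Vector_Spaces.linear (\<lambda>a x. e a *s x) (*s) \<Phi>" and bij: "bij \<Phi>"
    and D: "D = (\<lambda>P. \<Phi> ` P) ` pg_spaces 0"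
    using assms(1) unfolding desarguesian_spread_def by blast
  have \<Phi>_add: "\<Phi> (u + v) = \<Phi> u + \<Phi> v" for u v
    using lin by (rule Vector_Spaces.linear.axioms(3)[THEN module_hom.add])
  have \<Phi>_scale: "\<Phi> (e a *s v) = a *s \<Phi> v" for a v
    using lin by (rule Vector_Spaces.linear.axioms(3)[THEN module_hom.scale])
  have elt: "\<exists>v. v \<noteq> 0 \<and> U = range (\<lambda>c. \<Phi> (c *s v))" if "U \<in> D" for U
    using that unfolding D by (force elim!: pg_spaces_0E)
  obtain a b c where a: "a \<noteq> 0" "A = range (\<lambda>c. \<Phi> (c *s a))"
    and b: "b \<noteq> 0" "B = range (\<lambda>c. \<Phi> (c *s b))"
    and c: "c \<noteq> 0" "C = range (\<lambda>z. \<Phi> (z *s c))"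
    using elt ABC by metis
  have rescale: "range (\<lambda>c. \<Phi> (c *s (z *s v))) = range (\<lambda>c. \<Phi> (c *s v))" if "z \<noteq> 0" for z v
  proof (intro equalityI subsetI)
    fix w assume "w \<in> range (\<lambda>c. \<Phi> (c *s v))"
    then obtain t where "w = \<Phi> (t *s v)" by blast
    then show "w \<in> range (\<lambda>c. \<Phi> (c *s (z *s v)))"
      using that by (intro image_eqI[of _ _ "t / z"]) auto
  qed auto
  \<comment> \<open>Otherwise \<open>b\<close> would be a multiple of \<open>a\<close>, and the
    distinct elements \<open>A\<close> and \<open>B\<close> would coincide.\<close>
  have indep: "x = 0 \<and> y = 0" if "x *s a + y *s b = 0" for x y
  proof -
    have "y = 0"
    proof (rule ccontr)
      assume "y \<noteq> 0"
      then have "b = (- x / y) *s a"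
        using that by (simp add: vec_eq_iff field_simps add_eq_0_iff)
      moreover then have "- x / y \<noteq> 0" using b(1) by auto
      ultimately have "B = A"
        using rescale a(2) b(2) by metis
      then show False using ABC by simp
    qed
    then show ?thesis using that a(1) by auto
  qed
  have "inj (\<lambda>(x, y). x *s a + y *s b)"
  proof (rule injI, clarsimp)
    fix x y x' y' assume "x *s a + y *s b = x' *s a + y' *s b"
    then have "(x - x') *s a + (y - y') *s b = 0"
      by (simp add: vec_eq_iff algebra_simps)
    from indep[OF this] show "x = x' \<and> y = y'" by simp
  qed
  \<comment> \<open>Generation by counting: an injective map from pairs over \<open>'k\<close> to
    \<open>'k ^ 2\<close> is onto, both sets having the same finite size.\<close>
  then have "range (\<lambda>(x, y). x *s a + y *s b) = UNIV"
    by (intro card_subset_eq) (auto simp: card_image card_cartesian_product power2_eq_square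
      simp flip: UNIV_Times_UNIV)
  then have gen: "\<exists>x y. v = x *s a + y *s b" for v
    by (metis (no_types, lifting) UNIV_I case_prod_conv image_iff surj_pair)
  obtain \<alpha> \<beta> where \<alpha>\<beta>: "c = \<alpha> *s a + \<beta> *s b" using gen by blast
  have "\<alpha> \<noteq> 0"
  proof
    assume "\<alpha> = 0"
    then have "\<beta> \<noteq> 0" "c = \<beta> *s b" using \<alpha>\<beta> c(1) by auto
    then have "C = B" using rescale b(2) c(2) by metis
    then show False using ABC by simp
  qed
  have "\<beta> \<noteq> 0"
  proof
    assume "\<beta> = 0"
    then have "\<alpha> \<noteq> 0" "c = \<alpha> *s a" using \<alpha>\<beta> c(1) by auto
    then have "C = A" using rescale a(2) c(2) by metis
    then show False using ABC by simp
  qed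
  \<comment> \<open>Replacing \<open>a\<close> and \<open>b\<close> by \<alpha> a and \<beta> b
    turns \<open>c\<close> into their sum, which gives \<open>C\<close> slope 1. Both factors are
    nonzero because \<open>C\<close> differs from \<open>A\<close> and \<open>B\<close>, so
    \<open>A\<close> and \<open>B\<close> are unaffected.\<close>
  define \<phi> where "\<phi> x y = \<Phi> (x *s (\<alpha> *s a) + y *s (\<beta> *s b))" for x y
  interpret plane_coordinates e \<phi>
  proof
    show "\<phi> (x + x') (y + y') = \<phi> x y + \<phi> x' y'" for x x' y y'
      by (simp add: \<phi>_def \<Phi>_add[symmetric] vec_eq_iff algebra_simps)
    show "\<phi> (e s * x) (e s * y) = s *s \<phi> x y" for s x y
      by (simp add: \<phi>_def \<Phi>_scale[symmetric] vec_eq_iff algebra_simps)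
    show "\<phi> x y = \<phi> x' y' \<longleftrightarrow> x = x' \<and> y = y'" for x y x' y'
    proof
      assume "\<phi> x y = \<phi> x' y'"
      then have "x *s (\<alpha> *s a) + y *s (\<beta> *s b) = x' *s (\<alpha> *s a) + y' *s (\<beta> *s b)"
        using bij unfolding \<phi>_def by (simp add: bij_def inj_eq del: vec.scale_scale)
      then have "((x - x') * \<alpha>) *s a + ((y - y') * \<beta>) *s b = 0"
        by (simp add: vec_eq_iff algebra_simps)
      from indep[OF this] show "x = x' \<and> y = y'"
        using \<open>\<alpha> \<noteq> 0\<close> \<open>\<beta> \<noteq> 0\<close> by simp
    qed auto
    show "\<exists>x y. v = \<phi> x y" for v
    proof -
      obtain u where u: "v = \<Phi> u" using bij by (metis bij_pointE)
      obtain x y where "u = x *s a + y *s b" using gen by blast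
      then have "v = \<phi> (x / \<alpha>) (y / \<beta>)"
        using \<open>\<alpha> \<noteq> 0\<close> \<open>\<beta> \<noteq> 0\<close> u by (simp add: \<phi>_def)
      then show ?thesis by blast
    qed
  qed
  have A: "A = slope 0"
    unfolding a(2) slope_def \<phi>_def using rescale[OF \<open>\<alpha> \<noteq> 0\<close>] by simp
  have B: "B = vertical"
    unfolding b(2) vertical_def \<phi>_def using rescale[OF \<open>\<beta> \<noteq> 0\<close>] by simp
  have C: "C = slope 1"
    unfolding c(2) slope_def \<phi>_def \<alpha>\<beta> by (simp add: vec.scale_right_distrib)
  have span: "range (\<lambda>z. \<Phi> (z *s (x *s (\<alpha> *s a) + y *s (\<beta> *s b)))) = range (\<lambda>z. \<phi> (x * z) (y * z))"
    for x y by (simp add: \<phi>_def vec.scale_right_distrib mult.commute mult.left_commute)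
  have "D \<subseteq> spread"
  proof
    fix U assume "U \<in> D"
    then obtain v where v: "v \<noteq> 0" "U = range (\<lambda>c. \<Phi> (c *s v))"
      using elt by blast
    obtain x y where "\<Phi> v = \<phi> x y" using surj by blast
    then have vxy: "v = x *s (\<alpha> *s a) + y *s (\<beta> *s b)"
      using bij by (simp add: \<phi>_def bij_def inj_eq del: vec.scale_scale)
    then have U: "U = range (\<lambda>z. \<phi> (x * z) (y * z))"
      using v(2) span by metis
    \<comment> \<open>\<open>U\<close> is the point with homogeneous coordinates (x : y); its slope
      is y / x, with x = 0 giving the point at infinity.\<close>
    show "U \<in> spread"
    proof (cases "x = 0")
      case True
      then have "y \<noteq> 0" using vxy v(1) by auto
      then have "\<phi> 0 t \<in> U" for t
        unfolding U using True by (intro image_eqI[of _ _ "t / y"]) auto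
      then have "U = vertical"
        unfolding U vertical_def using True by auto
      then show ?thesis by (simp add: spread_def)
    next
      case False
      then have "\<phi> t (y / x * t) \<in> U" for t
        unfolding U by (intro image_eqI[of _ _ "t / x"]) auto
      moreover have "\<phi> (x * z) (y * z) \<in> slope (y / x)" for z
        using False by (simp add: in_slope_iff)
      ultimately have "U = slope (y / x)"
        unfolding U slope_def by auto
      then show ?thesis by (simp add: spread_def)
    qed
  qed
  moreover have "spread \<subseteq> D"
  proof -
    have *: "range (\<lambda>z. \<phi> (x * z) (y * z)) \<in> D" if "x \<noteq> 0 \<or> y \<noteq> 0" for x y
    proof -
      let ?v = "x *s (\<alpha> *s a) + y *s (\<beta> *s b)"
      have "\<Phi> 0 = 0" using \<Phi>_add[of 0 0] by simp
      then have "?v \<noteq> 0" using eq_0_iff[of x y] that by (auto simp: \<phi>_def)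
      then have "\<Phi> ` range (\<lambda>c. c *s ?v) \<in> D"
        unfolding D by (blast intro: pg_spaces_0I)
      then show ?thesis
        unfolding span[symmetric] by (simp add: image_image)
    qed
    show ?thesis
      using *[of 0 1] *[of 1] by (auto simp: spread_def vertical_def slope_def)
  qed
  ultimately have "D = spread" by blast
  then show thesis
    by (rule that[OF plane_coordinates_axioms _ A B C])
qed

section \<open>The subfield attached to two spreads with three common elements\<close>

text \<open>In coordinates adapted to three common elements, the identity of the ambient space becomes
  \<open>(x, y) \<mapsto> (f x, f y)\<close>, and the common elements correspond to the multiplications of \<open>'k\<close>
  that \<open>f\<close> conjugates to multiplications.\<close>

lemma common_elements:
  fixes e :: "'a::field \<Rightarrow> 'k::{field,finite}" and D1 D2 :: "('a ^ 'm) set set"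
  assumes "desarguesian_spread e D1" and "desarguesian_spread e D2"
    and ABC: "A \<in> D1 \<inter> D2" "B \<in> D1 \<inter> D2" "C \<in> D1 \<inter> D2" "A \<noteq> B" "A \<noteq> C" "B \<noteq> C"
  obtains \<phi> S where "plane_coordinates e \<phi>" and "D1 = plane_coordinates.spread \<phi>"
    and "A = plane_coordinates.slope \<phi> 0" and "B = plane_coordinates.vertical \<phi>"
    and "C = plane_coordinates.slope \<phi> 1" and "subfield_set S" and "range e \<subseteq> S"
    and "D1 \<inter> D2 = insert (plane_coordinates.vertical \<phi>) (plane_coordinates.slope \<phi> ` S)"
proof -
  obtain \<phi> where c1: "plane_coordinates e \<phi>" and D1: "D1 = plane_coordinates.spread \<phi>"
    and A1: "A = plane_coordinates.slope \<phi> 0" and B1: "B = plane_coordinates.vertical \<phi>"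
    and C1: "C = plane_coordinates.slope \<phi> 1"
    using desarguesian_spread_coordinates[of e D1 A B C] assms by blast
  obtain \<psi> where c2: "plane_coordinates e \<psi>" and D2: "D2 = plane_coordinates.spread \<psi>"
    and A2: "A = plane_coordinates.slope \<psi> 0" and B2: "B = plane_coordinates.vertical \<psi>"
    and C2: "C = plane_coordinates.slope \<psi> 1"
    using desarguesian_spread_coordinates[of e D2 A B C] assms by blast
  interpret P: plane_coordinates e \<phi> by (rule c1)
  interpret Q: plane_coordinates e \<psi> by (rule c2)
  \<comment> \<open>\<open>A\<close> is the horizontal axis in both coordinate systems; likewise
    \<open>B\<close> is the vertical axis in both. The change of coordinates is therefore diagonal,
    with entries \<open>f\<close> and \<open>g\<close>.\<close>
  have "\<exists>u. \<psi> x 0 = \<phi> u 0" for x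
  proof -
    have "\<psi> x 0 \<in> P.slope 0" using A1 A2 Q.in_slope_iff[of x 0 0] by simp
    then show ?thesis by (auto simp: P.slope_def)
  qed
  then obtain f where f: "\<And>x. \<psi> x 0 = \<phi> (f x) 0" by metis
  have "\<exists>u. \<psi> 0 y = \<phi> 0 u" for y
  proof -
    have "\<psi> 0 y \<in> P.vertical" using B1 B2 Q.in_vertical_iff[of 0 y] by simp
    then show ?thesis by (auto simp: P.vertical_def)
  qed
  then obtain g where g: "\<And>y. \<psi> 0 y = \<phi> 0 (g y)" by metis
  have fg: "\<psi> x y = \<phi> (f x) (g y)" for x y
    using Q.add[of x 0 0 y] P.add[of "f x" 0 0 "g y"] f g by simp
  \<comment> \<open>The diagonal \<open>C\<close> is also preserved, which forces the two entries to
    agree.\<close>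
  have "g x = f x" for x
  proof -
    have "\<psi> x x \<in> P.slope 1" using C1 C2 Q.in_slope_iff[of x x 1] by simp
    then show ?thesis by (simp add: fg P.in_slope_iff)
  qed
  then have \<psi>: "\<psi> x y = \<phi> (f x) (f y)" for x y using fg by simp
  have "\<psi> 0 0 = \<phi> 0 0" by (simp add: P.zero Q.zero)
  then have f0: "f 0 = 0" by (simp add: \<psi> P.inj)
  have f_add: "f (x + y) = f x + f y" for x y
    using Q.add[of x y 0 0] P.add[of "f x" "f y" 0 0] P.inj[of "f (x + y)" 0 "f x + f y" 0] by (simp add: \<psi> f0)
  have f_diff: "f (x - y) = f x - f y" for x y
    using f_add[of "x - y" y] by (simp add: algebra_simps)
  have f_scale: "f (e a * x) = e a * f x" for a x
  proof -
    have "\<phi> (f (e a * x)) 0 = \<phi> (e a * f x) 0"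
      using Q.scale[of a x 0] P.scale[of a "f x" 0] by (simp add: \<psi> f0)
    then show ?thesis using P.inj by blast
  qed
  have f_inj: "f x = f y \<longleftrightarrow> x = y" for x y
    using Q.inj[of x 0 y 0] by (simp add: \<psi> P.inj)
  have "surj f"
    using f_inj by (intro finite_UNIV_inj_surj) (auto simp: inj_on_def)
  \<comment> \<open>The \<open>c\<close> for which multiplication by \<open>c\<close> is the
    conjugate under \<open>f\<close> of multiplication by some \<open>m\<close>.\<close>
  define S where "S = {c. \<exists>m. \<forall>x. f (m * x) = c * f x}"
  have SI: "c \<in> S" if "\<And>x. f (m * x) = c * f x" for c m
    using that by (auto simp: S_def)
  have "subfield_set S"
    unfolding subfield_set_def
  proof (intro conjI ballI)
    show "0 \<in> S" by (rule SI[of 0]) (simp add: f0)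
    show "1 \<in> S" by (rule SI[of 1]) simp
  next
    fix c d assume "c \<in> S" "d \<in> S"
    then obtain m m' where *: "\<And>x. f (m * x) = c * f x" "\<And>x. f (m' * x) = d * f x"
      unfolding S_def by blast
    show "c - d \<in> S"
      by (rule SI[of "m - m'"]) (simp add: left_diff_distrib f_diff *)
    show "c * d \<in> S"
      by (rule SI[of "m * m'"]) (simp add: mult.assoc *)
  next
    fix c assume "c \<in> S"
    then obtain m where *: "\<And>x. f (m * x) = c * f x"
      unfolding S_def by blast
    \<comment> \<open>For m = 0 also c = 0, and both inverses are 0 by convention. Otherwise the
      relation is evaluated at \<open>inverse m * x\<close>.\<close>
    have "f (inverse m * x) = inverse c * f x" for x
    proof (cases "m = 0")
      case True
      then have "c = 0" using *[of 1] f0 f_inj[of 1 0] by auto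
      then show ?thesis using True f0 by simp
    next
      case False
      then have "f x = c * f (inverse m * x)" using *[of "inverse m * x"] by (simp flip: mult.assoc)
      moreover have "c \<noteq> 0" using *[of 1] f0 f_inj[of m 0] False by auto
      ultimately show ?thesis by simp
    qed
    then show "inverse c \<in> S" by (rule SI)
  qed
  moreover have "range e \<subseteq> S"
    using SI[OF f_scale] by (rule image_subsetI)
  moreover have "D1 \<inter> D2 = insert P.vertical (P.slope ` S)"
  proof -
    \<comment> \<open>The vectors of \<open>Q.slope m\<close> have coordinates (f x, f (m x)) with
      respect to \<open>\<phi>\<close>. Surjectivity of \<open>f\<close> makes them fill all of
      \<open>P.slope c\<close> once they lie in it.\<close>
    have "Q.slope m = P.slope c \<longleftrightarrow> (\<forall>x. f (m * x) = c * f x)" for m c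
    proof
      assume "Q.slope m = P.slope c"
      then have "\<psi> x (m * x) \<in> P.slope c" for x
        using Q.in_slope_iff by blast
      then show "\<forall>x. f (m * x) = c * f x"
        by (simp add: \<psi> P.in_slope_iff)
    next
      assume "\<forall>x. f (m * x) = c * f x"
      then have "Q.slope m = range (\<lambda>x. \<phi> (f x) (c * f x))"
        by (simp add: Q.slope_def \<psi>)
      also have "\<dots> = (\<lambda>x. \<phi> x (c * x)) ` range f"
        by (simp add: image_image)
      finally show "Q.slope m = P.slope c"
        using \<open>surj f\<close> by (simp add: P.slope_def)
    qed
    then have *: "P.slope c \<in> range Q.slope \<longleftrightarrow> c \<in> S" for c
      by (auto simp: S_def image_iff eq_commute[of "P.slope c"])
    have "Q.vertical = P.vertical" using B1 B2 by simp
    then have "D1 \<inter> D2 = insert P.vertical (range P.slope \<inter> range Q.slope)"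
      by (simp add: D1 D2 P.spread_def Q.spread_def)
    also have "range P.slope \<inter> range Q.slope = P.slope ` S"
      using * by blast
    finally show ?thesis .
  qed
  ultimately show thesis
    by (rule that[OF c1 D1 A1 B1 C1])
qed

section \<open>Reguli: the case of q + 1 common elements\<close>

lemma three_distinct_elements:
  assumes "card X \<ge> 3"
  obtains A B C where "A \<in> X" "B \<in> X" "C \<in> X" "A \<noteq> B" "A \<noteq> C" "B \<noteq> C"
proof -
  obtain T where "T \<subseteq> X" "card T = 3"
    using assms by (meson obtain_subset_with_card_n)
  then show thesis
    using that by (auto simp: card_3_iff)
qed

text \<open>For a line meeting three elements, coordinates adapted to these three show that it is
  spanned by points with coordinates \<open>(z, 0)\<close> and \<open>(0, z)\<close>.\<close>

lemma common_elements_regulus: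
  fixes e :: "'a::{field,finite} \<Rightarrow> 'k::{field,finite}" and D1 D2 :: "('a ^ 'm::finite) set set"
  assumes D: "desarguesian_spread e D1" "desarguesian_spread e D2"
    and "inj e" and card: "card (D1 \<inter> D2) = CARD('a) + 1" and ge3: "card (D1 \<inter> D2) \<ge> 3"
    and k: "CARD('k) = CARD('a) ^ n" and "n > 0"
  shows "regulus n (D1 \<inter> D2)"
  unfolding regulus_def
proof (intro conjI ballI impI card)
  obtain A B C where "A \<in> D1 \<inter> D2" "B \<in> D1 \<inter> D2" "C \<in> D1 \<inter> D2" "A \<noteq> B" "A \<noteq> C" "B \<noteq> C"
    using ge3 by (rule three_distinct_elements)
  then obtain \<phi> where c1: "plane_coordinates e \<phi>" and D1: "D1 = plane_coordinates.spread \<phi>"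
    using desarguesian_spread_coordinates[of e D1 A B C] D by blast
  interpret P: plane_coordinates e \<phi> by (rule c1)
  have a2: "CARD('a) > 1"
    using card_mono[of UNIV "{0, 1::'a}"] by simp
  have sub: "vec.subspace U" if "U \<in> D1 \<inter> D2" for U
    using that P.subspace_spread D1 by blast
  show "D1 \<inter> D2 \<subseteq> pg_spaces (n - 1)"
  proof
    fix U assume U: "U \<in> D1 \<inter> D2"
    \<comment> \<open>A spread element is in bijection with \<open>'k\<close>; comparing exponents
      of \<open>CARD('a)\<close> yields vector dimension \<open>n\<close>.\<close>
    have "card U = CARD('a) ^ n"
      using P.card_spread_element[of U] U D1 k by simp
    then have "vec.dim U = n"
      using card_subspace[OF sub[OF U]] a2 by simp
    then show "U \<in> pg_spaces (n - 1)"
      using sub[OF U] \<open>n > 0\<close> by (simp add: pg_spaces_def)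
  qed
  show "\<not> pg_meets U W" if "U \<in> D1 \<inter> D2" "W \<in> D1 \<inter> D2" "U \<noteq> W" for U W
    using that pg_meets_iff[OF sub sub, of U W] P.disjoint_spread D1 by blast
next
  fix L U
  assume L: "L \<in> pg_spaces 1" and U: "U \<in> D1 \<inter> D2"
    and "\<exists>A\<in>D1 \<inter> D2. \<exists>B\<in>D1 \<inter> D2. \<exists>C\<in>D1 \<inter> D2. A \<noteq> B \<and> A \<noteq> C \<and> B \<noteq> C \<and>
           pg_meets L A \<and> pg_meets L B \<and> pg_meets L C"
  then obtain A B C where ABC: "A \<in> D1 \<inter> D2" "B \<in> D1 \<inter> D2" "C \<in> D1 \<inter> D2"
    "A \<noteq> B" "A \<noteq> C" "B \<noteq> C" and meets: "pg_meets L A" "pg_meets L B" "pg_meets L C"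
    by blast
  \<comment> \<open>New coordinates are chosen for each line, adapted to the three elements that it
    meets.\<close>
  obtain \<phi> S where c1: "plane_coordinates e \<phi>" and D1: "D1 = plane_coordinates.spread \<phi>"
    and A: "A = plane_coordinates.slope \<phi> 0" and B: "B = plane_coordinates.vertical \<phi>"
    and C: "C = plane_coordinates.slope \<phi> 1" and "range e \<subseteq> S"
    and I: "D1 \<inter> D2 = insert (plane_coordinates.vertical \<phi>) (plane_coordinates.slope \<phi> ` S)"
    using common_elements[OF D ABC] by metis
  interpret P: plane_coordinates e \<phi> by (rule c1)
  \<comment> \<open>The count of common elements leaves no room in \<open>S\<close> beyond the
    ground field, so all non-vertical common elements have slopes \<open>e a\<close>.\<close>
  have "card S = CARD('a)"
    using P.card_slopes[of S] I card by simp
  then have S: "S = range e"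
    using \<open>range e \<subseteq> S\<close> \<open>inj e\<close> by (metis card_image card_subset_eq finite)
  have Ls: "vec.subspace L" and Ld: "vec.dim L = 2"
    using L by (auto simp: pg_spaces_def)
  have sub: "vec.subspace W" if "W \<in> D1 \<inter> D2" for W
    using that P.subspace_spread D1 by blast
  obtain u v w where u: "u \<noteq> 0" "u \<in> L" "u \<in> A" and v: "v \<noteq> 0" "v \<in> L" "v \<in> B"
    and w: "w \<noteq> 0" "w \<in> L" "w \<in> C"
    using meets ABC pg_meets_iff[OF Ls sub] by meson
  obtain x where x: "u = \<phi> x 0" using u(3) A by (auto simp: P.slope_def)
  obtain y where y: "v = \<phi> 0 y" using v(3) B by (auto simp: P.vertical_def)
  obtain z where z: "w = \<phi> z z" using w(3) C by (auto simp: P.slope_def)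
  have nz: "x \<noteq> 0" "y \<noteq> 0" "z \<noteq> 0"
    using u(1) v(1) w(1) x y z by (auto simp: P.zero)
  have lc: "r *s u + s *s v = \<phi> (e r * x) (e s * y)" for r s
    using P.scale[of r x 0] P.scale[of s 0 y] P.add[of "e r * x" 0 0 "e s * y"] x y by simp
  \<comment> \<open>Multiples of \<open>u\<close> have second coordinate 0, whereas \<open>v\<close>
    has second coordinate \<open>y \<noteq> 0\<close>. Hence \<open>u\<close> and \<open>v\<close>
    span the line.\<close>
  have vu: "v \<notin> vec.span {u}"
  proof
    assume "v \<in> vec.span {u}"
    then obtain r where "v = r *s u" by (auto simp: vec.span_singleton)
    then have "\<phi> 0 y = \<phi> (e r * x) (e r * 0)"
      using P.scale[of r x 0] x y by simp
    then show False
      using nz by (simp add: P.inj)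
  qed
  then have "vec.independent {v, u}" "v \<noteq> u"
    using u(1) vec.span_base[of v "{u}"] by (auto simp: vec.independent_insert)
  then have "L \<subseteq> vec.span {v, u}"
    using vec.card_ge_dim_independent[of "{v, u}" L] u v Ld by simp
  then obtain r s where "w = r *s u + s *s v"
    using w(2) by (force simp: vec.span_insert vec.span_singleton algebra_simps)
  \<comment> \<open>Since \<open>w\<close> has equal coordinates, the components of \<open>w\<close>
    along \<open>u\<close> and \<open>v\<close> are (z, 0) and (0, z); both lie on
    \<open>L\<close>.\<close>
  then have rs: "z = e r * x" "z = e s * y"
    using z P.inj[of z z "e r * x" "e s * y"] lc by metis+
  have L1: "\<phi> z 0 \<in> L"
    using P.scale[of r x 0] rs(1) x u(2) Ls by (simp add: vec.subspace_scale)
  have L2: "\<phi> 0 z \<in> L"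
    using P.scale[of s 0 y] rs(2) y v(2) Ls by (simp add: vec.subspace_scale)
  have "\<exists>v. v \<noteq> 0 \<and> v \<in> L \<and> v \<in> U"
  proof (cases "U = P.vertical")
    case True
    then show ?thesis
      using L2 nz by (intro exI[of _ "\<phi> 0 z"]) (simp add: P.in_vertical_iff P.eq_0_iff)
  next
    case False
    then obtain a where a: "U = P.slope (e a)" using U I S by blast
    have "\<phi> z (e a * z) = \<phi> z 0 + a *s \<phi> 0 z"
      using P.scale[of a 0 z] P.add[of z 0 0 "e a * z"] by simp
    then have "\<phi> z (e a * z) \<in> L"
      using L1 L2 Ls by (simp add: vec.subspace_add vec.subspace_scale)
    then show ?thesis
      using a nz by (intro exI[of _ "\<phi> z (e a * z)"]) (simp add: P.in_slope_iff P.eq_0_iff)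
  qed
  then show "pg_meets L U"
    using pg_meets_iff[OF Ls sub[OF U]] by blast
qed

section \<open>Field embeddings and the final count\<close>

lemma field_embedding_zero: "field_embedding e \<Longrightarrow> e 0 = 0"
  unfolding field_embedding_def by (metis add_cancel_right_right)

text \<open>A nonzero difference is invertible and \<open>e\<close> preserves products and 1, so its
  image cannot vanish.\<close>

lemma inj_field_embedding:
  assumes "field_embedding e"
  shows "inj e"
proof (rule injI, rule ccontr)
  fix x y assume "e x = e y" "x \<noteq> y"
  have "e ((x - y) * inverse (x - y)) = 1"
    using assms \<open>x \<noteq> y\<close> by (simp add: field_embedding_def)
  moreover have "e (x - y) + e y = e y"
    using assms \<open>e x = e y\<close> unfolding field_embedding_def by (metis diff_add_cancel)
  ultimately show False
    using assms by (simp add: field_embedding_def)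
qed

lemma subfield_set_range_field_embedding:
  assumes "field_embedding e"
  shows "subfield_set (range e)"
proof -
  have e: "e 1 = 1" "\<And>x y. e (x + y) = e x + e y" "\<And>x y. e (x * y) = e x * e y"
    using assms by (auto simp: field_embedding_def)
  note e0 = field_embedding_zero[OF assms]
  have ed: "e x - e y = e (x - y)" for x y
    using e(2)[of "x - y" y] by simp
  have ei: "inverse (e x) = e (inverse x)" for x
  proof (cases "x = 0")
    case False
    then show ?thesis
      using e(3)[of x "inverse x"] by (intro inverse_unique) (simp add: e(1))
  qed (simp add: e0)
  show ?thesis
    unfolding subfield_set_def
    using e0 e(1) by (auto simp: ed ei e(3)[symmetric] image_iff)
qed

theorem corollary1p6:
  fixes p h q n :: nat
    and e :: "'a::{field,finite} \<Rightarrow> 'k::{field,finite}"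
    and D1 D2 :: "('a ^ 'm::finite) set set"
  assumes "prime p" and "q = p ^ h" and "q > 2"
    and "CARD('a) = q" and "CARD('k) = q ^ n" and "field_embedding e"
    and "CARD('m) = 2 * n"
    and "desarguesian_spread e D1" and "desarguesian_spread e D2"
    and "card (D1 \<inter> D2) \<ge> 3"
  shows "(\<exists>t. t dvd n \<and> card (D1 \<inter> D2) = q ^ t + 1) \<and>
         (prime n \<longrightarrow> regulus n (D1 \<inter> D2) \<or> D1 = D2)"
proof -
  have inj: "inj e" using \<open>field_embedding e\<close> by (rule inj_field_embedding)
  obtain A B C where ABC: "A \<in> D1 \<inter> D2" "B \<in> D1 \<inter> D2" "C \<in> D1 \<inter> D2" "A \<noteq> B" "A \<noteq> C" "B \<noteq> C"
    using \<open>card (D1 \<inter> D2) \<ge> 3\<close> by (rule three_distinct_elements)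
  obtain \<phi> S where c1: "plane_coordinates e \<phi>" and D1: "D1 = plane_coordinates.spread \<phi>"
    and S: "subfield_set S" "range e \<subseteq> S"
    and I: "D1 \<inter> D2 = insert (plane_coordinates.vertical \<phi>) (plane_coordinates.slope \<phi> ` S)"
    using common_elements[OF \<open>desarguesian_spread e D1\<close> \<open>desarguesian_spread e D2\<close> ABC] by metis
  \<comment> \<open>Coordinates for the second spread are wanted only to count its elements when
    \<open>t = n\<close>.\<close>
  obtain \<psi> where c2: "plane_coordinates e \<psi>" and D2: "D2 = plane_coordinates.spread \<psi>"
    using desarguesian_spread_coordinates[OF \<open>desarguesian_spread e D2\<close>, of A B C] ABC by blast
  interpret P: plane_coordinates e \<phi> by (rule c1)
  interpret Q: plane_coordinates e \<psi> by (rule c2)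
  have cardI: "card (D1 \<inter> D2) = card S + 1"
    using P.card_slopes[of S] I by simp
  have card_e: "card (range e) = q"
    using inj \<open>CARD('a) = q\<close> by (simp add: card_image)
  have S_add: "x + y \<in> S" if "x \<in> S" "y \<in> S" for x y
  proof -
    have "x - (0 - y) \<in> S" using S(1) that unfolding subfield_set_def by blast
    then show ?thesis by simp
  qed
  \<comment> \<open>\<open>S\<close> is regarded as a module over the ground field, which has
    \<open>q\<close> elements.\<close>
  have "\<exists>t. card S = card (range e) ^ t"
  proof (rule card_submodule_power)
    show "subfield_set (range e)"
      using \<open>field_embedding e\<close> by (rule subfield_set_range_field_embedding)
  qed (use S S_add in \<open>auto simp: subfield_set_def\<close>)
  then obtain t where t: "card S = q ^ t" using card_e by auto
  \<comment> \<open>Here the whole of \<open>'k\<close> is a module over \<open>S\<close>; comparing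
    exponents of \<open>q\<close> gives n = t r.\<close>
  obtain r where "CARD('k) = card S ^ r"
    using card_submodule_power[OF S(1), of UNIV] by auto
  then have "q ^ n = q ^ (t * r)"
    using \<open>CARD('k) = q ^ n\<close> t by (simp add: power_mult)
  then have "n = t * r"
    using \<open>q > 2\<close> by simp
  then have "t dvd n" by simp
  moreover have "regulus n (D1 \<inter> D2) \<or> D1 = D2" if n: "prime n"
  proof -
    consider "t = 1" | "t = n"
      using \<open>t dvd n\<close> n unfolding prime_nat_iff by blast
    then show ?thesis
    proof cases
      case 1
      then have "regulus n (D1 \<inter> D2)"
        using assms inj cardI t prime_gt_0_nat[OF n]
        by (intro common_elements_regulus[of e]) auto
      then show ?thesis ..
    next
      case 2
      \<comment> \<open>The intersection is as large as each of the finite sets \<open>D1\<close>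
        and \<open>D2\<close>, so it equals both.\<close>
      then have "card (D1 \<inter> D2) = CARD('k) + 1"
        using cardI t \<open>CARD('k) = q ^ n\<close> by simp
      moreover have "card D1 = CARD('k) + 1" "card D2 = CARD('k) + 1"
        using P.card_slopes[of UNIV] Q.card_slopes[of UNIV] D1 D2
        by (simp_all add: P.spread_def Q.spread_def)
      ultimately have "D1 \<inter> D2 = D1" and "D1 \<inter> D2 = D2"
        by (intro card_subset_eq; simp)+
      then show ?thesis by blast
    qed
  qed
  ultimately show ?thesis
    using cardI t by auto
qed

end
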